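(* Let $E$ be a finite-dimensional Euclidean space, let $f : E \to \mathbb{R}$ be a convex function, let $x \in E$ be fixed, and let $\epsilon > 0$. Then for any $\upsilon < \epsilon$ there exists a constant $L_{\epsilon,\upsilon}$ such that \[ d\big(\partial_{\epsilon'} f(x), \partial_{\epsilon''} f(x)\big) \le L_{\epsilon,\upsilon}\, |\epsilon' - \epsilon''| \] for any $\epsilon', \epsilon'' \in [\epsilon - \upsilon, \epsilon + \upsilon]$.
   Context: $E$ is equipped with the inner product $xy$ and norm $\|x\| = \sqrt{xx}$. For $\epsilon \ge 0$, the $\epsilon$-subdifferential of $f$ at $x$ is the set $\partial_\epsilon f(x) = \{ g \in E : f(y) - f(x) \ge g(y - x) - \epsilon \text{ for all } y \in E \}$. The Hausdorff distance between sets $X, Y \subset E$ is $d(X,Y) = \max\{ d^0(X,Y), d^0(Y,X) \}$, where $d^0(X,Y) = \max_{x \in X} \min_{y \in Y} \|x - y\|$ (equivalently, for nonempty compact sets, $d^0(X,Y) = \inf\{\delta \ge 0 : X \subset Y + \delta B\}$ with $B$ the closed unit ball). *)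

theory Defs
  imports "HOL-Analysis.Analysis"
begin

definition eps_subdifferential :: "real \<Rightarrow> ('a::euclidean_space \<Rightarrow> real) \<Rightarrow> 'a \<Rightarrow> 'a set"
  where "eps_subdifferential \<epsilon> f x = {g. \<forall>y. f y - f x \<ge> g \<bullet> (y - x) - \<epsilon>}"

text \<open>
  The maximum and the minimum in the Hausdorff distance are rendered as supremum and infimum;
  \<open>excess_attained\<close> shows that both are attained on nonempty compact sets, and
  \<open>eps_subdifferential_nonempty\<close> and \<open>eps_subdifferential_compact\<close> that the subdifferentials of
  convex functions are of this kind. For other arguments the value has no meaning.
\<close>

definition excess :: "'a::euclidean_space set \<Rightarrow> 'a set \<Rightarrow> real"
  where "excess X Y = (SUP x\<in>X. INF y\<in>Y. norm (x - y))"

definition hausdorff_distance :: "'a::euclidean_space set \<Rightarrow> 'a set \<Rightarrow> real"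
  where "hausdorff_distance X Y = max (excess X Y) (excess Y X)"

lemma excess_attained:
  fixes X Y :: "'a::euclidean_space set"
  assumes "compact X" "X \<noteq> {}" "compact Y" "Y \<noteq> {}"
  obtains x y where "x \<in> X" "y \<in> Y" "excess X Y = norm (x - y)"
    "\<forall>y'\<in>Y. norm (x - y) \<le> norm (x - y')"
    "\<forall>x'\<in>X. \<exists>y'\<in>Y. norm (x' - y') \<le> norm (x - y)"
proof -
  have ex: "excess X Y = (SUP x\<in>X. infdist x Y)"
    using assms(4) by (simp add: excess_def infdist_def dist_norm)
  have "continuous_on X (\<lambda>x. infdist x Y)"
    by (intro continuous_intros)
  then obtain x where x: "x \<in> X" "\<forall>x'\<in>X. infdist x' Y \<le> infdist x Y"
    using continuous_attains_sup[OF assms(1,2)] by blast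
  have sup: "excess X Y = infdist x Y"
    unfolding ex using x by (intro cSup_eq_maximum) auto
  have att: "\<exists>y\<in>Y. infdist z Y = norm (z - y)" for z
    using infdist_attains_inf[OF compact_imp_closed[OF assms(3)] assms(4), of z]
    by (metis dist_norm)
  then obtain y where y: "y \<in> Y" "infdist x Y = norm (x - y)" by blast
  show thesis
  proof
    show "x \<in> X" "y \<in> Y" "excess X Y = norm (x - y)" using x y sup by auto
    show "\<forall>y'\<in>Y. norm (x - y) \<le> norm (x - y')"
      using y infdist_le by (metis dist_norm)
    show "\<forall>x'\<in>X. \<exists>y'\<in>Y. norm (x' - y') \<le> norm (x - y)"
      using x y att by metis
  qed
qed

lemma eps_subdifferential_nonempty:
  fixes f :: "'a::euclidean_space \<Rightarrow> real"
  assumes "convex_on UNIV f" "\<epsilon> > 0"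
  shows "eps_subdifferential \<epsilon> f x \<noteq> {}"
proof -
  have cont: "continuous_on UNIV f"
    using assms(1) by (intro convex_on_continuous) auto
  have "closed (epigraph UNIV f)"
  proof -
    have "closed {p :: 'a \<times> real. f (fst p) \<le> snd p}"
      by (intro closed_Collect_le continuous_intros continuous_on_compose2[OF cont]) auto
    then show ?thesis by (simp add: epigraph_def)
  qed
  moreover have "(x, f x - \<epsilon>) \<notin> epigraph UNIV f"
    using assms(2) by (simp add: epigraph_def)
  ultimately obtain p c where pc: "p \<bullet> (x, f x - \<epsilon>) < c" "\<forall>q\<in>epigraph UNIV f. p \<bullet> q > c"
    using separating_hyperplane_closed_point convex_epigraphI[OF assms(1)] by metis
  obtain a b where p: "p = (a, b)" by (cases p)
  have 1: "a \<bullet> x + b * (f x - \<epsilon>) < c" using pc(1) by (simp add: p)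
  have 2: "a \<bullet> y + b * f y > c" for y
    using pc(2)[rule_format, of "(y, f y)"] by (simp add: p epigraph_def)
  have "b * \<epsilon> > 0" using 1 2[of x] by (simp add: algebra_simps)
  then have b: "b > 0" using assms(2) by (simp add: zero_less_mult_iff)
  have "f y - f x \<ge> (- a /\<^sub>R b) \<bullet> (y - x) - \<epsilon>" for y
  proof -
    have "b * ((- a /\<^sub>R b) \<bullet> (y - x) - \<epsilon>) = - (a \<bullet> (y - x)) - b * \<epsilon>"
      using b by (simp add: right_diff_distrib)
    also have "\<dots> \<le> b * (f y - f x)"
      using 1 2[of y] by (simp add: algebra_simps)
    finally show ?thesis using b by simp
  qed
  then show ?thesis unfolding eps_subdifferential_def by blast
qed

lemma eps_subdifferential_compact:
  fixes f :: "'a::euclidean_space \<Rightarrow> real"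
  assumes "convex_on UNIV f"
  shows "compact (eps_subdifferential \<epsilon> f x)"
proof -
  have "continuous_on (cball x 1) f"
    using convex_on_continuous[OF open_UNIV assms] continuous_on_subset by blast
  then obtain z where z: "\<forall>y\<in>cball x 1. f y \<le> f z"
    using continuous_attains_sup[of "cball x 1" f] by auto
  have "norm g \<le> \<bar>f z - f x + \<epsilon>\<bar>" if g: "g \<in> eps_subdifferential \<epsilon> f x" for g
  proof (cases "g = 0")
    case False
    let ?y = "x + g /\<^sub>R norm g"
    have "g \<bullet> (?y - x) = norm g"
      using False by (simp add: dot_square_norm power2_eq_square)
    moreover have "f ?y - f x \<ge> g \<bullet> (?y - x) - \<epsilon>"
      using g unfolding eps_subdifferential_def by blast
    moreover have "f ?y \<le> f z" using z False by (auto simp: dist_norm)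
    ultimately show ?thesis by linarith
  qed auto
  then have "bounded (eps_subdifferential \<epsilon> f x)"
    unfolding bounded_iff by blast
  moreover have "closed (eps_subdifferential \<epsilon> f x)"
    unfolding eps_subdifferential_def
    by (intro closed_Collect_all closed_Collect_le continuous_intros)
  ultimately show ?thesis by (simp add: compact_eq_bounded_closed)
qed

end

theory Submission
  imports Defs
begin

text \<open>
  The map \<open>\<epsilon> \<mapsto> \<partial>\<^sub>\<epsilon> f(x)\<close> has a convex graph: a convex combination of an \<open>a\<close>-subgradient and a
  \<open>b\<close>-subgradient is a subgradient for the same combination of \<open>a\<close> and \<open>b\<close>
  (\<open>eps_subdifferential_convex_combination\<close>). It is also monotone, so for \<open>a \<le> b\<close> only the excess
  of \<open>\<partial>\<^sub>b f(x)\<close> over \<open>\<partial>\<^sub>a f(x)\<close> matters.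

  Choose \<open>c\<close> strictly between \<open>0\<close> and every tolerance allowed, and a \<open>c\<close>-subgradient \<open>h\<close>. A
  \<open>b\<close>-subgradient \<open>g\<close> is moved towards \<open>h\<close> until its tolerance has dropped from \<open>b\<close> to \<open>a\<close>; this
  takes the fraction \<open>(b - a) / (b - c)\<close> of the segment from \<open>g\<close> to \<open>h\<close>
  (\<open>eps_subdifferential_approximation\<close>). The length of the segment is bounded because the largest
  subdifferential in question is compact, and \<open>b - c\<close> is bounded away from zero by the choice of
  \<open>c\<close>. So the displacement is at most a constant times \<open>b - a\<close>.
\<close>

lemma eps_subdifferential_mono:
  assumes "a \<le> b"
  shows "eps_subdifferential a f x \<subseteq> eps_subdifferential b f x"
  using assms by (auto simp: eps_subdifferential_def intro: order_trans[rotated])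

text \<open>
  For each test point the defining inequality is affine in the pair of subgradient and tolerance, so
  such pairs form an intersection of half-spaces.
\<close>

lemma eps_subdifferential_convex_combination:
  assumes g: "g \<in> eps_subdifferential a f x" and h: "h \<in> eps_subdifferential b f x"
    and t: "0 \<le> t" "t \<le> 1"
  shows "(1 - t) *\<^sub>R g + t *\<^sub>R h \<in> eps_subdifferential ((1 - t) * a + t * b) f x"
  unfolding eps_subdifferential_def
proof (intro CollectI allI)
  fix y
  have "(1 - t) * (g \<bullet> (y - x) - a) \<le> (1 - t) * (f y - f x)"
    using g t by (intro mult_left_mono) (auto simp: eps_subdifferential_def)
  moreover have "t * (h \<bullet> (y - x) - b) \<le> t * (f y - f x)"
    using h t by (intro mult_left_mono) (auto simp: eps_subdifferential_def)
  ultimately show "f y - f x \<ge> ((1 - t) *\<^sub>R g + t *\<^sub>R h) \<bullet> (y - x) - ((1 - t) * a + t * b)"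
    by (simp add: inner_add_left algebra_simps)
qed

text \<open>
  Moving from \<open>g\<close> towards \<open>h\<close> lowers the tolerance at a constant rate, from \<open>b\<close> to \<open>c\<close> over the
  whole segment. The factor is the fraction of the way at which it equals \<open>a\<close>.
\<close>

lemma eps_subdifferential_approximation:
  assumes g: "g \<in> eps_subdifferential b f x" and h: "h \<in> eps_subdifferential c f x"
    and "c < b" "c \<le> a" "a \<le> b"
  obtains g' where "g' \<in> eps_subdifferential a f x"
    "norm (g - g') = (b - a) / (b - c) * norm (g - h)"
proof
  \<comment> \<open>the solution of \<open>(1 - t) * b + t * c = a\<close>\<close>
  define t where "t = (b - a) / (b - c)"
  have t: "0 \<le> t" "t \<le> 1" using assms(3-5) by (simp_all add: t_def)
  have "t * (b - c) = b - a" using assms(3) by (simp add: t_def)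
  then have "(1 - t) * b + t * c = a" by (simp add: algebra_simps)
  then show "(1 - t) *\<^sub>R g + t *\<^sub>R h \<in> eps_subdifferential a f x"
    using eps_subdifferential_convex_combination[OF g h t] by simp
  have "g - ((1 - t) *\<^sub>R g + t *\<^sub>R h) = t *\<^sub>R (g - h)" by (simp add: algebra_simps)
  then show "norm (g - ((1 - t) *\<^sub>R g + t *\<^sub>R h)) = (b - a) / (b - c) * norm (g - h)"
    using t(1) unfolding t_def[symmetric] by simp
qed

lemma excess_le:
  assumes "X \<noteq> {}" and "\<And>x. x \<in> X \<Longrightarrow> \<exists>y\<in>Y. norm (x - y) \<le> d"
  shows "excess X Y \<le> d"
  unfolding excess_def
proof (rule cSUP_least[OF assms(1)])
  fix x assume "x \<in> X"
  then obtain y where "y \<in> Y" "norm (x - y) \<le> d" using assms(2) by blast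
  moreover have "bdd_below ((\<lambda>y. norm (x - y)) ` Y)" by (rule bdd_belowI2[of _ 0]) simp
  ultimately show "(INF y\<in>Y. norm (x - y)) \<le> d" by (rule cINF_lower2[rotated])
qed

lemma hausdorff_distance_commute: "hausdorff_distance X Y = hausdorff_distance Y X"
  by (simp add: hausdorff_distance_def max.commute)

theorem theorem4:
  fixes f :: "'a::euclidean_space \<Rightarrow> real" and x :: 'a and \<epsilon> :: real
  assumes "convex_on UNIV f" and "\<epsilon> > 0"
  shows "\<forall>\<upsilon><\<epsilon>. \<exists>L::real. \<forall>\<epsilon>'\<in>{\<epsilon> - \<upsilon>..\<epsilon> + \<upsilon>}. \<forall>\<epsilon>''\<in>{\<epsilon> - \<upsilon>..\<epsilon> + \<upsilon>}.
    hausdorff_distance (eps_subdifferential \<epsilon>' f x) (eps_subdifferential \<epsilon>'' f x)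
      \<le> L * \<bar>\<epsilon>' - \<epsilon>''\<bar>"
proof (intro allI impI)
  fix \<upsilon> assume "\<upsilon> < \<epsilon>"
  let ?S = "\<lambda>e. eps_subdifferential e f x"
  \<comment> \<open>half of the smallest tolerance, so that \<open>b - c \<ge> c\<close> for every tolerance \<open>b\<close>\<close>
  define c where "c = (\<epsilon> - \<upsilon>) / 2"
  have c: "c > 0" "\<epsilon> - \<upsilon> = 2 * c" using \<open>\<upsilon> < \<epsilon>\<close> by (auto simp: c_def)
  obtain h where h: "h \<in> ?S c"
    using eps_subdifferential_nonempty[OF assms(1) c(1)] by blast
  obtain M where M: "\<And>g. g \<in> ?S (\<epsilon> + \<upsilon>) \<Longrightarrow> norm g \<le> M"
    using compact_imp_bounded[OF eps_subdifferential_compact[OF assms(1)]]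
    unfolding bounded_iff by metis
  define L where "L = 2 * M / c"
  have ordered: "hausdorff_distance (?S a) (?S b) \<le> L * (b - a)"
    if ab: "\<epsilon> - \<upsilon> \<le> a" "a \<le> b" "b \<le> \<epsilon> + \<upsilon>" for a b
  proof -
    have "c < b" "c \<le> a" using ab c by linarith+
    then have h_a: "h \<in> ?S a" and h_b: "h \<in> ?S b"
      using h eps_subdifferential_mono[of c a f x] eps_subdifferential_mono[of c b f x] by auto
    have M_b: "norm g \<le> M" if "g \<in> ?S b" for g
      using M that eps_subdifferential_mono[OF ab(3)] by blast
    have "M \<ge> 0" using M_b[OF h_b] norm_ge_zero order_trans by blast
    then have L_ge: "L * (b - a) \<ge> 0" using c ab by (simp add: L_def)
    have "excess (?S a) (?S b) \<le> L * (b - a)"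
    proof (rule excess_le)
      show "?S a \<noteq> {}" using h_a by blast
      show "\<exists>g'\<in>?S b. norm (g - g') \<le> L * (b - a)" if "g \<in> ?S a" for g
        using that eps_subdifferential_mono[OF ab(2)] L_ge by (intro bexI[of _ g]) auto
    qed
    moreover have "excess (?S b) (?S a) \<le> L * (b - a)"
    proof (rule excess_le)
      show "?S b \<noteq> {}" using h_b by blast
      fix g assume g: "g \<in> ?S b"
      obtain g' where g': "g' \<in> ?S a" "norm (g - g') = (b - a) / (b - c) * norm (g - h)"
        using eps_subdifferential_approximation[OF g h \<open>c < b\<close> \<open>c \<le> a\<close> ab(2)] by blast
      have "norm (g - h) \<le> 2 * M"
        using M_b[OF g] M_b[OF h_b] norm_triangle_ineq4[of g h] by linarith
      moreover have "(b - a) / (b - c) \<le> (b - a) / c"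
        using ab c by (intro divide_left_mono mult_pos_pos) auto
      ultimately have "norm (g - g') \<le> (b - a) / c * (2 * M)"
        unfolding g'(2) using ab c by (intro mult_mono) auto
      then have "norm (g - g') \<le> L * (b - a)" by (simp add: L_def mult_ac)
      then show "\<exists>g'\<in>?S a. norm (g - g') \<le> L * (b - a)" using g'(1) by blast
    qed
    ultimately show ?thesis by (simp add: hausdorff_distance_def)
  qed
  show "\<exists>L. \<forall>\<epsilon>'\<in>{\<epsilon> - \<upsilon>..\<epsilon> + \<upsilon>}. \<forall>\<epsilon>''\<in>{\<epsilon> - \<upsilon>..\<epsilon> + \<upsilon>}.
    hausdorff_distance (?S \<epsilon>') (?S \<epsilon>'') \<le> L * \<bar>\<epsilon>' - \<epsilon>''\<bar>"
  proof (intro exI ballI)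
    fix \<epsilon>' \<epsilon>'' assume "\<epsilon>' \<in> {\<epsilon> - \<upsilon>..\<epsilon> + \<upsilon>}" "\<epsilon>'' \<in> {\<epsilon> - \<upsilon>..\<epsilon> + \<upsilon>}"
    then show "hausdorff_distance (?S \<epsilon>') (?S \<epsilon>'') \<le> L * \<bar>\<epsilon>' - \<epsilon>''\<bar>"
      using ordered[of \<epsilon>' \<epsilon>''] ordered[of \<epsilon>'' \<epsilon>'] hausdorff_distance_commute[of "?S \<epsilon>'" "?S \<epsilon>''"]
      by (cases "\<epsilon>' \<le> \<epsilon>''") auto
  qed
qed

end
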